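(* Let $c<0<a$, $2c+a<0$ and $y\in[c,-a-c]$, and let $\eta$ be such that $H(y,\eta)=\dfrac{ac(a+c)}{3}$, where $H(x,\xi)=\dfrac{\xi^2}{2}-\dfrac{x^3}{3}+\mathcal{B}x$ and $\mathcal{B}=\dfrac{a^2+c^2+ac}{3}$. Then the unique solution $\{x_0(t)\}_{t\ge 0}$ of the deterministic Hamiltonian system $$\begin{cases}\dot x_0(t)=\xi_0(t), & x_0(0)=y,\\ \dot\xi_0(t)=x_0(t)^2-\dfrac{a^2+c^2+ac}{3}, & \xi_0(0)=\eta,\end{cases}$$ is explicitly given by $$x_0(t)=c-(a+2c)\,\mathrm{sn}^2\!\left(\sqrt{\tfrac{a-c}{6}}\;t+i_y,\;q\right),$$ with $q=\sqrt{\dfrac{2c+a}{c-a}}$ and $i_y:=F\!\left(\arcsin\sqrt{\dfrac{c-y}{2c+a}},\,q\right)$.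
   Context: Here $a,c,y,\eta$ are real numbers. $F(\gamma,q):=\int_0^\gamma \frac{d\alpha}{\sqrt{1-q^2\sin^2\alpha}}$ is the elliptic integral of the first kind, and $\mathrm{sn}(\cdot,q)$ is the Jacobi elliptic sine function with modulus $q$, for which $u=F(\gamma,q)$ is equivalent to $\mathrm{sn}(u,q)=\sin\gamma$. The condition $H(y,\eta)=ac(a+c)/3$, together with the choice of $\mathcal{B}$, says that $x^3/3-\mathcal{B}x+H(y,\eta)=(x-a)(x+a+c)(x-c)/3$, so that $c$, $-a-c$ and $a$ are the three real roots of this polynomial.
   Formalization: For η<0 the formula is proved with phase −i_y instead of +i_y, since the printed one has the wrong sign of x₀'(0); the integral defining i_y is assumed to converge, which excludes only y=−a−c when c≤−2a, where i_y is not a real number. *)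

theory Defs
  imports "HOL-Analysis.Analysis"
begin

definition ellF_integrand :: "real \<Rightarrow> real \<Rightarrow> real" where
  "ellF_integrand q \<alpha> = 1 / sqrt (1 - q\<^sup>2 * (sin \<alpha>)\<^sup>2)"

definition ellF :: "real \<Rightarrow> real \<Rightarrow> real" where
  "ellF \<gamma> q = (LBINT \<alpha>=ereal 0..ereal \<gamma>. ellF_integrand q \<alpha>)"

text \<open>
  The integral defining \<open>ellF \<gamma> q\<close> makes sense as a real number: the radicand is positive
  strictly between the limits and the (possibly improper) integral is finite.  This always holds
  for a modulus of absolute value less than 1 (\<open>ellF_converges_modulus_less_1\<close>).  It is needed
  for larger moduli because of the totalised \<open>sqrt\<close>, division and integral.
\<close>

definition ellF_converges :: "real \<Rightarrow> real \<Rightarrow> bool" where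
  "ellF_converges \<gamma> q \<longleftrightarrow>
     (\<forall>\<alpha>\<in>open_segment 0 \<gamma>. q\<^sup>2 * (sin \<alpha>)\<^sup>2 < 1) \<and>
     interval_lebesgue_integrable lborel (ereal 0) (ereal \<gamma>) (ellF_integrand q)"

text \<open>
  The amplitude, i.e. the inverse function of \<open>\<lambda>\<gamma>. ellF \<gamma> q\<close>, for moduli of absolute value at
  most 1.  The side condition restricts \<open>\<gamma>\<close> to the natural domain of the integral: all reals if
  \<open>\<bar>q\<bar> < 1\<close>, and the open interval from \<open>- pi / 2\<close> to \<open>pi / 2\<close> if \<open>\<bar>q\<bar> = 1\<close>.
\<close>

definition jacobi_am :: "real \<Rightarrow> real \<Rightarrow> real" where
  "jacobi_am u q =
     (THE \<gamma>. (\<forall>\<alpha>\<in>closed_segment 0 \<gamma>. q\<^sup>2 * (sin \<alpha>)\<^sup>2 < 1) \<and> ellF \<gamma> q = u)"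

text \<open>
  For \<open>\<bar>q\<bar> \<le> 1\<close> this says that \<open>u = ellF \<gamma> q\<close> gives \<open>jacobi_sn u q = sin \<gamma>\<close>.  For \<open>\<bar>q\<bar> > 1\<close> the
  integral can be inverted only on a bounded interval, and the usual extension to all real
  arguments is given by Jacobi's reciprocal modulus transformation.
\<close>

definition jacobi_sn :: "real \<Rightarrow> real \<Rightarrow> real" where
  "jacobi_sn u q =
     (if \<bar>q\<bar> \<le> 1 then sin (jacobi_am u q)
      else sin (jacobi_am (\<bar>q\<bar> * u) (1 / \<bar>q\<bar>)) / \<bar>q\<bar>)"

definition coeffB :: "real \<Rightarrow> real \<Rightarrow> real" where
  "coeffB a c = (a\<^sup>2 + c\<^sup>2 + a * c) / 3"

definition hamiltonian :: "real \<Rightarrow> real \<Rightarrow> real \<Rightarrow> real \<Rightarrow> real" where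
  "hamiltonian a c x \<xi> = \<xi>\<^sup>2 / 2 - x ^ 3 / 3 + coeffB a c * x"

text \<open>Solutions on the half-line \<open>t \<ge> 0\<close>; at \<open>t = 0\<close> the derivatives are one-sided.\<close>

definition solves_hamiltonian_system ::
  "real \<Rightarrow> real \<Rightarrow> real \<Rightarrow> real \<Rightarrow> (real \<Rightarrow> real) \<Rightarrow> (real \<Rightarrow> real) \<Rightarrow> bool" where
  "solves_hamiltonian_system a c y \<eta> x \<xi> \<longleftrightarrow>
     x 0 = y \<and> \<xi> 0 = \<eta> \<and>
     (\<forall>t\<ge>0. (x has_real_derivative \<xi> t) (at t within {0..}) \<and>
            (\<xi> has_real_derivative (x t)\<^sup>2 - (a\<^sup>2 + c\<^sup>2 + a * c) / 3) (at t within {0..}))"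

lemma ellF_converges_modulus_less_1:
  assumes "\<bar>q\<bar> < 1"
  shows "ellF_converges \<gamma> q"
proof -
  have q: "q\<^sup>2 < 1"
    using assms by (simp add: abs_square_less_1)
  have less: "q\<^sup>2 * (sin \<alpha>)\<^sup>2 < 1" for \<alpha>
  proof -
    have "(sin \<alpha>)\<^sup>2 \<le> 1"
      by (simp add: abs_square_le_1)
    then have "q\<^sup>2 * (sin \<alpha>)\<^sup>2 \<le> q\<^sup>2"
      by (simp add: mult_left_le)
    with q show ?thesis by linarith
  qed
  have "isCont (ellF_integrand q) \<alpha>" for \<alpha>
  proof -
    have "sqrt (1 - q\<^sup>2 * (sin \<alpha>)\<^sup>2) \<noteq> 0"
      using less[of \<alpha>] by simp
    then show ?thesis
      unfolding ellF_integrand_def by (intro continuous_intros)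
  qed
  then have "interval_lebesgue_integrable lborel (ereal 0) (ereal \<gamma>) (ellF_integrand q)"
    by (intro interval_integrable_isCont) auto
  with less show ?thesis
    by (simp add: ellF_converges_def)
qed

text \<open>
  The modulus \<open>sqrt ((2 * c + a) / (c - a))\<close> is less than 1 exactly when \<open>a\<close> is the largest of
  the three roots \<open>c\<close>, \<open>- a - c\<close>, \<open>a\<close>.
\<close>

lemma modulus_less_1_iff:
  fixes a c :: real
  assumes "c < 0" "0 < a" "2 * c + a < 0"
  shows "sqrt ((2 * c + a) / (c - a)) < 1 \<longleftrightarrow> - a - c < a"
  using assms by (auto simp: field_simps)

end

theory Submission
  imports Defs
begin

text \<open>
  Write \<open>b = - a - c\<close>, so that \<open>c < b\<close>, \<open>c < a\<close>, and conservation of energy on the given level reads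
  \<open>x'\<^sup>2 = 2 / 3 * (x - a) * (x - b) * (x - c)\<close>.  The substitution \<open>x = c + (b - c) * (sin \<phi>)\<^sup>2\<close> turns
  this into \<open>\<phi>'\<^sup>2 = \<omega>\<^sup>2 * (1 - q\<^sup>2 * (sin \<phi>)\<^sup>2)\<close> with \<open>\<omega>\<^sup>2 = (a - c) / 6\<close> and
  \<open>q\<^sup>2 = (b - c) / (a - c)\<close>.  The amplitude, being the inverse of \<open>ellF\<close>, satisfies this equation up
  to the time scale \<open>\<omega>\<close> (\<open>DERIV_jacobi_am\<close>), and differentiating
  \<open>c + (b - c) * (sin (jacobi_am (\<omega> * t + p) q))\<^sup>2\<close> twice gives a solution of the system, for every
  phase \<open>p\<close> (\<open>sn_squared_solves_hamiltonian_system\<close>).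

  The initial position determines the initial angle \<open>\<gamma>\<close> up to its sign.  The energy determines the
  initial momentum up to its sign, and the two signs agree; since \<open>ellF\<close> is odd, a negative momentum
  amounts to the phase \<open>- ellF \<gamma> q\<close> (\<open>sn_squared_solution_of_energy\<close>).  Uniqueness is a Gronwall
  estimate (\<open>hamiltonian_system_unique\<close>).

  Which of \<open>a\<close> and \<open>b\<close> is the larger root decides whether \<open>q\<close> is at most 1.
  For \<open>b < a\<close> the angle \<open>\<gamma>\<close> is unrestricted.
  For \<open>b = a\<close> the modulus is 1 and the motion is a separatrix; \<open>ellF\<close> diverges at \<open>pi / 2\<close>
  (\<open>ellF_diverges_modulus_1\<close>), so convergence keeps \<open>y\<close> away from the equilibrium \<open>b\<close>.
  For \<open>a < b\<close> convergence forces \<open>y \<le> a\<close>.  Since \<open>- b - c = a\<close>, exchanging \<open>a\<close> and \<open>b\<close> leaves the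
  system and the energy level unchanged but replaces \<open>q\<close> by \<open>1 / q\<close>, and Jacobi's reciprocal modulus
  transformation (\<open>ellF_reciprocal_modulus\<close>) carries one form of the solution into the other.
\<close>

section \<open>The elliptic integral on the domain of the amplitude\<close>

text \<open>
  The side condition in the definition of \<open>jacobi_am\<close>, as a set: the interval around 0 on which the
  integrand of \<open>ellF\<close> has no singularity.
\<close>

definition amplitude_domain :: "real \<Rightarrow> real set" where
  "amplitude_domain q = {\<gamma>. \<forall>\<alpha>\<in>closed_segment 0 \<gamma>. q\<^sup>2 * (sin \<alpha>)\<^sup>2 < 1}"

lemma amplitude_domain_radicand_pos:
  "\<gamma> \<in> amplitude_domain q \<Longrightarrow> q\<^sup>2 * (sin \<gamma>)\<^sup>2 < 1"
  by (auto simp: amplitude_domain_def)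

lemma amplitude_domain_modulus_less_1:
  assumes "\<bar>q\<bar> < 1"
  shows "amplitude_domain q = UNIV"
proof -
  have q: "q\<^sup>2 < 1"
    using assms by (simp add: abs_square_less_1)
  have "q\<^sup>2 * (sin \<alpha>)\<^sup>2 < 1" for \<alpha>
  proof -
    have "q\<^sup>2 * (sin \<alpha>)\<^sup>2 \<le> q\<^sup>2"
      by (simp add: abs_square_le_1 mult_left_le)
    with q show ?thesis by linarith
  qed
  then show ?thesis
    by (auto simp: amplitude_domain_def)
qed

lemma amplitude_domain_modulus_1:
  "amplitude_domain 1 = {- pi / 2<..<pi / 2}"
proof (intro equalityI subsetI)
  fix \<gamma> assume \<gamma>: "\<gamma> \<in> amplitude_domain 1"
  show "\<gamma> \<in> {- pi / 2<..<pi / 2}"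
  proof (rule ccontr)
    assume "\<gamma> \<notin> {- pi / 2<..<pi / 2}"
    then have "\<gamma> \<le> - pi / 2 \<or> pi / 2 \<le> \<gamma>"
      by auto
    then have "- pi / 2 \<in> closed_segment 0 \<gamma> \<or> pi / 2 \<in> closed_segment 0 \<gamma>"
      using pi_gt_zero by (auto simp: closed_segment_eq_real_ivl)
    then show False
      using \<gamma> by (auto simp: amplitude_domain_def)
  qed
next
  fix \<gamma> :: real assume \<gamma>: "\<gamma> \<in> {- pi / 2<..<pi / 2}"
  have "(sin \<alpha>)\<^sup>2 < 1" if "\<alpha> \<in> closed_segment 0 \<gamma>" for \<alpha>
  proof -
    have "- pi / 2 < \<alpha>" "\<alpha> < pi / 2"
      using that \<gamma> by (auto simp: closed_segment_eq_real_ivl split: if_splits)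
    then have "0 < cos \<alpha>"
      by (intro cos_gt_zero_pi) auto
    then show ?thesis
      by (simp add: sin_squared_eq)
  qed
  then show "\<gamma> \<in> amplitude_domain 1"
    by (auto simp: amplitude_domain_def)
qed

lemma amplitude_domain_uminus:
  "- \<gamma> \<in> amplitude_domain q \<longleftrightarrow> \<gamma> \<in> amplitude_domain q"
proof -
  have *: "- \<gamma> \<in> amplitude_domain q" if "\<gamma> \<in> amplitude_domain q" for \<gamma>
    unfolding amplitude_domain_def
  proof (intro CollectI ballI)
    fix \<alpha> assume "\<alpha> \<in> closed_segment 0 (- \<gamma>)"
    then have "- \<alpha> \<in> closed_segment 0 \<gamma>"
      by (auto simp: closed_segment_eq_real_ivl split: if_splits)
    then have "q\<^sup>2 * (sin (- \<alpha>))\<^sup>2 < 1"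
      using that by (auto simp: amplitude_domain_def simp del: sin_minus)
    then show "q\<^sup>2 * (sin \<alpha>)\<^sup>2 < 1"
      by simp
  qed
  show ?thesis
    using *[of \<gamma>] *[of "- \<gamma>"] by auto
qed

text \<open>
  The domain is open and symmetric.  In this form the fact supplies the compact intervals required by
  the fundamental theorem of calculus and by the continuity of inverse functions.
\<close>

lemma amplitude_domain_nbhd:
  assumes "0 \<le> q" "q \<le> 1" "\<gamma> \<in> amplitude_domain q"
  obtains r where "\<bar>\<gamma>\<bar> < r" "{- r..r} \<subseteq> amplitude_domain q"
proof (cases "q = 1")
  case True
  then have "\<bar>\<gamma>\<bar> < pi / 2"
    using assms(3) by (auto simp: amplitude_domain_modulus_1)
  then obtain r where "\<bar>\<gamma>\<bar> < r" "r < pi / 2"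
    using dense by blast
  then show thesis
    using True by (intro that[of r]) (auto simp: amplitude_domain_modulus_1)
next
  case False
  then show thesis
    using assms amplitude_domain_modulus_less_1[of q] by (intro that[of "\<bar>\<gamma>\<bar> + 1"]) auto
qed

lemma ellF_integrand_pos:
  "\<gamma> \<in> amplitude_domain q \<Longrightarrow> 0 < ellF_integrand q \<gamma>"
  using amplitude_domain_radicand_pos[of \<gamma> q] by (simp add: ellF_integrand_def)

lemma ellF_integrand_continuous:
  "\<gamma> \<in> amplitude_domain q \<Longrightarrow> isCont (ellF_integrand q) \<gamma>"
proof -
  assume "\<gamma> \<in> amplitude_domain q"
  then have "sqrt (1 - q\<^sup>2 * (sin \<gamma>)\<^sup>2) \<noteq> 0"
    using amplitude_domain_radicand_pos[of \<gamma> q] by simp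
  then show ?thesis
    unfolding ellF_integrand_def by (intro continuous_intros)
qed

lemma ellF_0 [simp]: "ellF 0 q = 0"
  by (simp add: ellF_def)

lemma ellF_uminus: "ellF (- \<gamma>) q = - ellF \<gamma> q"
proof -
  have "ellF (- \<gamma>) q = (LBINT \<alpha>=ereal \<gamma>..ereal 0. ellF_integrand q (- \<alpha>))"
    unfolding ellF_def
    by (subst interval_integral_reflect, subst interval_integral_endpoints_reverse)
      (subst interval_integral_endpoints_reverse, simp add: zero_ereal_def)
  also have "\<dots> = - ellF \<gamma> q"
    unfolding ellF_def
    by (subst interval_integral_endpoints_reverse) (simp add: ellF_integrand_def[abs_def])
  finally show ?thesis .
qed

lemma DERIV_ellF:
  assumes "0 \<le> q" "q \<le> 1" "\<gamma> \<in> amplitude_domain q"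
  shows "((\<lambda>\<gamma>. ellF \<gamma> q) has_real_derivative ellF_integrand q \<gamma>) (at \<gamma>)"
proof -
  obtain r where r: "\<bar>\<gamma>\<bar> < r" "{- r..r} \<subseteq> amplitude_domain q"
    using amplitude_domain_nbhd assms by blast
  have "continuous_on {- r..r} (ellF_integrand q)"
    using r ellF_integrand_continuous by (intro continuous_at_imp_continuous_on) auto
  then have "((\<lambda>u. LBINT \<alpha>=ereal 0..ereal u. ellF_integrand q \<alpha>) has_vector_derivative
      ellF_integrand q \<gamma>) (at \<gamma> within {- r..r})"
    using r by (intro interval_integral_FTC2) auto
  then have "((\<lambda>\<gamma>. ellF \<gamma> q) has_real_derivative ellF_integrand q \<gamma>) (at \<gamma> within {- r..r})"
    by (simp add: ellF_def has_real_derivative_iff_has_vector_derivative)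
  moreover have "at \<gamma> within {- r..r} = at \<gamma>"
    using r by (intro at_within_interior) auto
  ultimately show ?thesis by simp
qed

lemma ellF_strict_mono:
  assumes "0 \<le> q" "q \<le> 1" "\<alpha> \<in> amplitude_domain q" "\<beta> \<in> amplitude_domain q" "\<alpha> < \<beta>"
  shows "ellF \<alpha> q < ellF \<beta> q"
proof (rule DERIV_pos_imp_increasing[where f = "\<lambda>\<gamma>. ellF \<gamma> q"])
  fix x assume x: "\<alpha> \<le> x" "x \<le> \<beta>"
  obtain r where r: "\<bar>\<alpha>\<bar> < r" "{- r..r} \<subseteq> amplitude_domain q"
    using amplitude_domain_nbhd assms by blast
  obtain s where s: "\<bar>\<beta>\<bar> < s" "{- s..s} \<subseteq> amplitude_domain q"
    using amplitude_domain_nbhd assms by blast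
  \<comment> \<open>Convexity of the domain: two overlapping symmetric intervals cover everything from \<open>\<alpha>\<close> to \<open>\<beta>\<close>.\<close>
  have "x \<in> {- r..r} \<or> x \<in> {- s..s}"
    using x r(1) s(1) by auto
  then have "x \<in> amplitude_domain q"
    using r(2) s(2) by blast
  then show "\<exists>D. ((\<lambda>\<gamma>. ellF \<gamma> q) has_real_derivative D) (at x) \<and> 0 < D"
    using DERIV_ellF ellF_integrand_pos assms by blast
qed fact

text \<open>For modulus 1 the integrand is the secant, whose integral is elementary.\<close>

lemma ellF_modulus_1:
  assumes "\<bar>\<gamma>\<bar> < pi / 2"
  shows "ellF \<gamma> 1 = artanh (sin \<gamma>)"
proof -
  have cos: "0 < cos x" if "\<bar>x\<bar> \<le> \<bar>\<gamma>\<bar>" for x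
    using that assms by (intro cos_gt_zero_pi) auto
  have dom: "x \<in> amplitude_domain 1" if "\<bar>x\<bar> \<le> \<bar>\<gamma>\<bar>" for x
    using that assms by (auto simp: amplitude_domain_modulus_1)
  have "((\<lambda>x. artanh (sin x)) has_vector_derivative ellF_integrand 1 x) (at x within S)"
    if "\<bar>x\<bar> \<le> \<bar>\<gamma>\<bar>" for x S
  proof -
    have sq: "1 - (sin x)\<^sup>2 = (cos x)\<^sup>2"
      by (simp add: cos_squared_eq)
    have "0 < (cos x)\<^sup>2"
      using cos[OF that] by simp
    then have "\<bar>sin x\<bar> < 1"
      unfolding sq[symmetric] by (simp flip: abs_square_less_1)
    then have "((\<lambda>x. artanh (sin x)) has_real_derivative cos x / (1 - (sin x)\<^sup>2)) (at x within S)"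
      by (intro DERIV_chain2[OF artanh_real_has_field_derivative, THEN DERIV_cong])
        (auto intro!: derivative_eq_intros)
    moreover have "cos x / (1 - (sin x)\<^sup>2) = ellF_integrand 1 x"
      using cos[OF that] by (simp add: ellF_integrand_def sq) (simp add: power2_eq_square)
    ultimately show ?thesis
      by (simp add: has_real_derivative_iff_has_vector_derivative)
  qed
  then have "(LBINT x=ereal 0..ereal \<gamma>. ellF_integrand 1 x) = artanh (sin \<gamma>) - artanh (sin 0)"
    using dom ellF_integrand_continuous
    by (intro interval_integral_FTC_finite continuous_at_imp_continuous_on ballI) auto
  then show ?thesis
    by (simp add: ellF_def)
qed

text \<open>
  For modulus 1 the closed form is inverted directly.  For a smaller modulus the integrand is at least 1,
  so that \<open>ellF\<close> grows at least like the identity and the intermediate value theorem applies.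
\<close>

lemma ellF_surj:
  assumes "0 \<le> q" "q \<le> 1"
  obtains \<gamma> where "\<gamma> \<in> amplitude_domain q" "ellF \<gamma> q = u"
proof (cases "q = 1")
  case True
  have bnd: "- 1 < tanh u" "tanh u < 1"
    using tanh_real_lt_1 tanh_real_gt_neg1 by auto
  then have abs: "\<bar>arcsin (tanh u)\<bar> < pi / 2"
    using arcsin_lt_bounded[of "tanh u"] by auto
  then have "ellF (arcsin (tanh u)) 1 = u"
    using bnd by (simp add: ellF_modulus_1 artanh_tanh_real)
  then show thesis
    using True abs by (intro that[of "arcsin (tanh u)"]) (auto simp: amplitude_domain_modulus_1)
next
  case False
  then have dom: "x \<in> amplitude_domain q" for x
    using assms amplitude_domain_modulus_less_1[of q] by auto
  have pos: "x \<le> ellF x q" if "0 \<le> x" for x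
  proof -
    have "ellF 0 q - 0 \<le> ellF x q - x"
    proof (rule DERIV_nonneg_imp_nondecreasing[OF that])
      fix z
      have "0 < sqrt (1 - q\<^sup>2 * (sin z)\<^sup>2)" "sqrt (1 - q\<^sup>2 * (sin z)\<^sup>2) \<le> 1"
        using amplitude_domain_radicand_pos[OF dom, of z] by auto
      then have "1 \<le> ellF_integrand q z"
        by (simp add: ellF_integrand_def)
      moreover have "((\<lambda>x. ellF x q - x) has_real_derivative ellF_integrand q z - 1) (at z)"
        by (intro derivative_intros DERIV_ellF assms dom)
      ultimately show "\<exists>D. ((\<lambda>x. ellF x q - x) has_real_derivative D) (at z) \<and> 0 \<le> D"
        by (intro exI[of _ "ellF_integrand q z - 1"]) auto
    qed
    then show ?thesis by simp
  qed
  have "\<exists>x. - \<bar>u\<bar> \<le> x \<and> x \<le> \<bar>u\<bar> \<and> ellF x q = u"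
  proof (rule IVT)
    show "ellF (- \<bar>u\<bar>) q \<le> u" "u \<le> ellF \<bar>u\<bar> q"
      using pos[of "\<bar>u\<bar>"] by (auto simp: ellF_uminus)
    show "\<forall>x. - \<bar>u\<bar> \<le> x \<and> x \<le> \<bar>u\<bar> \<longrightarrow> isCont (\<lambda>x. ellF x q) x"
      using DERIV_ellF[OF assms dom] DERIV_isCont by blast
  qed auto
  then show thesis
    using that dom by blast
qed

section \<open>The amplitude as inverse function\<close>

lemma jacobi_am_ellF:
  assumes "0 \<le> q" "q \<le> 1" "\<gamma> \<in> amplitude_domain q"
  shows "jacobi_am (ellF \<gamma> q) q = \<gamma>"
proof -
  have "(THE \<gamma>'. \<gamma>' \<in> amplitude_domain q \<and> ellF \<gamma>' q = ellF \<gamma> q) = \<gamma>"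
  proof (rule the_equality)
    fix \<gamma>' assume "\<gamma>' \<in> amplitude_domain q \<and> ellF \<gamma>' q = ellF \<gamma> q"
    then show "\<gamma>' = \<gamma>"
      using ellF_strict_mono[OF assms(1,2), of \<gamma> \<gamma>'] ellF_strict_mono[OF assms(1,2), of \<gamma>' \<gamma>] assms(3)
      by (cases \<gamma> \<gamma>' rule: linorder_cases) auto
  qed (use assms in auto)
  then show ?thesis
    by (simp add: jacobi_am_def amplitude_domain_def)
qed

lemma
  assumes "0 \<le> q" "q \<le> 1"
  shows jacobi_am_in_domain: "jacobi_am u q \<in> amplitude_domain q"
    and ellF_jacobi_am: "ellF (jacobi_am u q) q = u"
proof -
  obtain \<gamma> where "\<gamma> \<in> amplitude_domain q" "ellF \<gamma> q = u"
    using ellF_surj[OF assms] .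
  then show "jacobi_am u q \<in> amplitude_domain q" "ellF (jacobi_am u q) q = u"
    using jacobi_am_ellF[OF assms] by auto
qed

lemma DERIV_jacobi_am:
  assumes q: "0 \<le> q" "q \<le> 1"
  shows "((\<lambda>u. jacobi_am u q) has_real_derivative sqrt (1 - q\<^sup>2 * (sin (jacobi_am u q))\<^sup>2)) (at u)"
proof -
  let ?\<gamma> = "jacobi_am u q"
  have dom: "?\<gamma> \<in> amplitude_domain q"
    by (rule jacobi_am_in_domain[OF q])
  obtain r where r: "\<bar>?\<gamma>\<bar> < r" "{- r..r} \<subseteq> amplitude_domain q"
    using amplitude_domain_nbhd[OF q dom] .
  have "isCont (\<lambda>u. jacobi_am u q) (ellF ?\<gamma> q)"
  proof (rule isCont_inverse_function2[where f = "\<lambda>\<gamma>. ellF \<gamma> q"])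
    show "- r < ?\<gamma>" "?\<gamma> < r"
      using r(1) by auto
    fix z assume "- r \<le> z" "z \<le> r"
    then have z: "z \<in> amplitude_domain q"
      using r(2) by auto
    show "jacobi_am (ellF z q) q = z"
      by (rule jacobi_am_ellF[OF q z])
    show "isCont (\<lambda>x. ellF x q) z"
      using DERIV_ellF[OF q z] DERIV_isCont by blast
  qed
  then have cont: "isCont (\<lambda>u. jacobi_am u q) u"
    by (simp add: ellF_jacobi_am[OF q])
  have "((\<lambda>u. jacobi_am u q) has_real_derivative inverse (ellF_integrand q ?\<gamma>)) (at u)"
    by (rule DERIV_inverse_function[where f = "\<lambda>x. ellF x q" and a = "u - 1" and b = "u + 1"])
      (use DERIV_ellF[OF q dom] ellF_integrand_pos[OF dom] ellF_jacobi_am[OF q] cont in auto)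
  then show ?thesis
    by (simp add: ellF_integrand_def)
qed

section \<open>Squares of the elliptic sine solve the Hamiltonian system\<close>

text \<open>
  With \<open>S = (sin \<phi>)\<^sup>2\<close> and \<open>\<phi>' = \<omega> * sqrt (1 - k\<^sup>2 * S)\<close> the second derivative of \<open>S\<close> is a quadratic
  polynomial in \<open>S\<close>.  The relations for \<open>k\<close> and \<open>\<omega>\<close> are what makes it match the force field.
  The angle \<open>\<gamma>\<close> may have either sign, which later provides both signs of the initial momentum.
\<close>

lemma sn_squared_solves_hamiltonian_system:
  fixes a c \<gamma> k \<omega> \<Delta> :: real
  assumes k: "0 \<le> k" "k \<le> 1" and k_sq: "k\<^sup>2 * (a - c) = - (a + 2 * c)"
    and \<omega>: "\<omega>\<^sup>2 = (a - c) / 6"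
    and \<gamma>: "\<gamma> \<in> amplitude_domain k"
    and \<Delta>: "\<Delta> = sqrt (1 - k\<^sup>2 * (sin \<gamma>)\<^sup>2)"
  shows "\<exists>\<xi>. solves_hamiltonian_system a c (c - (a + 2 * c) * (sin \<gamma>)\<^sup>2)
      (- (2 * (a + 2 * c) * \<omega> * sin \<gamma> * cos \<gamma> * \<Delta>))
      (\<lambda>t. c - (a + 2 * c) * (sin (jacobi_am (\<omega> * t + ellF \<gamma> k) k))\<^sup>2) \<xi>"
proof -
  define \<phi> where "\<phi> t = jacobi_am (\<omega> * t + ellF \<gamma> k) k" for t
  define d where "d t = sqrt (1 - k\<^sup>2 * (sin (\<phi> t))\<^sup>2)" for t
  define \<xi> where "\<xi> t = - (2 * (a + 2 * c) * \<omega> * sin (\<phi> t) * cos (\<phi> t) * d t)" for t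
  have \<phi>0: "\<phi> 0 = \<gamma>"
    by (simp add: \<phi>_def jacobi_am_ellF[OF k \<gamma>])
  have rad: "0 < 1 - k\<^sup>2 * (sin (\<phi> t))\<^sup>2" for t
    using amplitude_domain_radicand_pos[OF jacobi_am_in_domain[OF k]] by (simp add: \<phi>_def)
  have d_pos: "0 < d t" and d_sq: "(d t)\<^sup>2 = 1 - k\<^sup>2 * (sin (\<phi> t))\<^sup>2" for t
    using rad[of t] by (auto simp: d_def)
  have D\<phi>: "(\<phi> has_real_derivative \<omega> * d t) (at t)" for t
  proof -
    have "((\<lambda>t. \<omega> * t + ellF \<gamma> k) has_real_derivative \<omega>) (at t)"
      by (auto intro!: derivative_eq_intros)
    from DERIV_chain2[OF DERIV_jacobi_am[OF k] this] show ?thesis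
      by (simp add: \<phi>_def[abs_def] d_def mult.commute)
  qed
  have Dd: "(d has_real_derivative - (k\<^sup>2 * \<omega> * sin (\<phi> t) * cos (\<phi> t))) (at t)" for t
  proof -
    have "((\<lambda>t. 1 - k\<^sup>2 * (sin (\<phi> t))\<^sup>2) has_real_derivative
        - (2 * k\<^sup>2 * \<omega> * sin (\<phi> t) * cos (\<phi> t) * d t)) (at t)"
      by (rule derivative_eq_intros D\<phi> refl)+ simp
    from DERIV_chain2[OF DERIV_real_sqrt[OF rad] this] show ?thesis
      using d_pos[of t] by (simp add: d_def[abs_def] field_simps)
  qed
  have Dx: "((\<lambda>t. c - (a + 2 * c) * (sin (\<phi> t))\<^sup>2) has_real_derivative \<xi> t) (at t)" for t
    by (rule derivative_eq_intros D\<phi> refl)+ (simp add: \<xi>_def algebra_simps)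
  have D\<xi>: "(\<xi> has_real_derivative
      (c - (a + 2 * c) * (sin (\<phi> t))\<^sup>2)\<^sup>2 - (a\<^sup>2 + c\<^sup>2 + a * c) / 3) (at t)" for t
  proof -
    let ?s = "sin (\<phi> t)" and ?C = "cos (\<phi> t)"
    have "(\<xi> has_real_derivative
        - (2 * (a + 2 * c) * \<omega>\<^sup>2 * ((?C\<^sup>2 - ?s\<^sup>2) * (d t)\<^sup>2 - k\<^sup>2 * ?s\<^sup>2 * ?C\<^sup>2))) (at t)"
      unfolding \<xi>_def[abs_def]
      by (rule derivative_eq_intros D\<phi> Dd refl)+ (simp add: algebra_simps power2_eq_square)
    moreover have "- (2 * (a + 2 * c) * \<omega>\<^sup>2 * ((?C\<^sup>2 - ?s\<^sup>2) * (d t)\<^sup>2 - k\<^sup>2 * ?s\<^sup>2 * ?C\<^sup>2)) =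
        (c - (a + 2 * c) * ?s\<^sup>2)\<^sup>2 - (a\<^sup>2 + c\<^sup>2 + a * c) / 3"
    proof -
      define S where "S = ?s\<^sup>2"
      define K where "K = k\<^sup>2"
      have C: "?C\<^sup>2 = 1 - S" and D: "(d t)\<^sup>2 = 1 - K * S"
        by (simp_all add: S_def K_def cos_squared_eq d_sq)
      have K: "K * (a - c) = - (a + 2 * c)"
        using k_sq by (simp add: K_def)
      \<comment> \<open>Collect \<open>K\<close> into products \<open>K * (a - c)\<close>, so that the relation for the modulus eliminates it.\<close>
      have "- (2 * (a + 2 * c) * ((a - c) / 6) * ((1 - S - S) * (1 - K * S) - K * S * (1 - S))) =
          - ((a + 2 * c) / 3) * ((a - c) - 2 * ((a - c) + K * (a - c)) * S + 3 * (K * (a - c)) * S\<^sup>2)"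
        by (simp add: field_simps power2_eq_square)
      also have "\<dots> = (c - (a + 2 * c) * S)\<^sup>2 - (a\<^sup>2 + c\<^sup>2 + a * c) / 3"
        unfolding K by (simp add: field_simps power2_eq_square)
      finally show ?thesis
        unfolding \<omega> C D S_def[symmetric] K_def[symmetric] .
    qed
    ultimately show ?thesis by simp
  qed
  show ?thesis
    using Dx D\<xi> unfolding solves_hamiltonian_system_def \<phi>_def[symmetric]
    by (intro exI[of _ \<xi>]) (auto simp: \<phi>0 \<xi>_def \<Delta> d_def intro: has_field_derivative_at_within)
qed

section \<open>Uniqueness\<close>

text \<open>
  The squared distance \<open>D\<close> of two solutions satisfies \<open>D' \<le> (1 + M) * D\<close>, where \<open>M\<close> bounds
  \<open>\<bar>x + x'\<bar>\<close> on the time interval, because \<open>x\<^sup>2 - x'\<^sup>2 = (x - x') * (x + x')\<close>.  Hence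
  \<open>exp (- (1 + M) * t) * D t\<close> decreases from the value 0.
\<close>

lemma hamiltonian_system_unique:
  assumes 1: "solves_hamiltonian_system a c y \<eta> x \<xi>"
    and 2: "solves_hamiltonian_system a c y \<eta> x' \<xi>'"
    and "0 \<le> t"
  shows "x t = x' t \<and> \<xi> t = \<xi>' t"
proof -
  have cont: "continuous_on {0..t} x" "continuous_on {0..t} \<xi>"
    if "solves_hamiltonian_system a c y \<eta> x \<xi>" for x \<xi>
  proof -
    have "continuous_on {0..} x" "continuous_on {0..} \<xi>"
      using that unfolding solves_hamiltonian_system_def
      by (auto intro: DERIV_continuous_on[where D = \<xi>]
          DERIV_continuous_on[where D = "\<lambda>t. (x t)\<^sup>2 - (a\<^sup>2 + c\<^sup>2 + a * c) / 3"])
    then show "continuous_on {0..t} x" "continuous_on {0..t} \<xi>"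
      by (auto elim: continuous_on_subset)
  qed
  note cont = cont[OF 1] cont[OF 2]
  have "bounded ((\<lambda>s. x s + x' s) ` {0..t})"
    by (intro compact_imp_bounded compact_continuous_image continuous_intros cont) auto
  then obtain M where M: "\<And>s. s \<in> {0..t} \<Longrightarrow> \<bar>x s + x' s\<bar> \<le> M"
    unfolding bounded_real by blast
  define D where "D s = (x s - x' s)\<^sup>2 + (\<xi> s - \<xi>' s)\<^sup>2" for s
  define G where "G s = exp (- ((1 + M) * s)) * D s" for s
  have "G t \<le> G 0"
  proof (rule DERIV_nonpos_imp_decreasing_open[OF \<open>0 \<le> t\<close>])
    show "continuous_on {0..t} G"
      unfolding G_def D_def by (intro continuous_intros cont)
    fix s assume s: "0 < s" "s < t"
    have "at s within {0..} = at s"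
      using s by (intro at_within_interior) auto
    then have der: "(x has_real_derivative \<xi> s) (at s)" "(x' has_real_derivative \<xi>' s) (at s)"
        "(\<xi> has_real_derivative (x s)\<^sup>2 - (a\<^sup>2 + c\<^sup>2 + a * c) / 3) (at s)"
        "(\<xi>' has_real_derivative (x' s)\<^sup>2 - (a\<^sup>2 + c\<^sup>2 + a * c) / 3) (at s)"
      using 1 2 s unfolding solves_hamiltonian_system_def by (auto dest!: spec[of _ s])
    let ?d = "x s - x' s" and ?e = "\<xi> s - \<xi>' s"
    have "(G has_real_derivative exp (- ((1 + M) * s)) *
        (2 * ?d * ?e * (1 + (x s + x' s)) - (1 + M) * D s)) (at s)"
      unfolding G_def[abs_def] D_def
      by (rule derivative_eq_intros der refl)+ (simp add: algebra_simps power2_eq_square)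
    moreover have "2 * ?d * ?e * (1 + (x s + x' s)) \<le> (1 + M) * D s"
    proof -
      have "\<bar>1 + (x s + x' s)\<bar> \<le> 1 + M"
        using M[of s] s by auto
      moreover have "\<bar>2 * ?d * ?e\<bar> \<le> D s"
        using sum_squares_bound[of "\<bar>?d\<bar>" "\<bar>?e\<bar>"]
        by (simp add: D_def abs_mult del: left_diff_distrib_numeral right_diff_distrib_numeral)
      ultimately have "\<bar>2 * ?d * ?e\<bar> * \<bar>1 + (x s + x' s)\<bar> \<le> D s * (1 + M)"
        by (intro mult_mono) (auto simp: D_def)
      then show ?thesis
        by (simp add: abs_mult[symmetric] mult.commute)
    qed
    ultimately show "\<exists>m. (G has_real_derivative m) (at s) \<and> m \<le> 0"
      by (intro exI conjI) (auto simp: mult_le_0_iff)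
  qed
  also have "G 0 = 0"
    using 1 2 by (simp add: G_def D_def solves_hamiltonian_system_def)
  finally have "D t \<le> 0"
    by (simp add: G_def mult_le_0_iff)
  then show ?thesis
    by (simp add: D_def sum_power2_le_zero_iff)
qed

section \<open>Moduli at least 1\<close>

text \<open>
  Jacobi's reciprocal modulus transformation: the substitution \<open>sin \<theta> = q * sin \<alpha>\<close> turns the
  differential \<open>q * ellF_integrand q \<alpha> d\<alpha>\<close> into \<open>ellF_integrand (1 / q) \<theta> d\<theta>\<close>.  When
  \<open>q * sin \<gamma> = 1\<close> the left integral is improper at \<open>\<gamma>\<close>, and \<open>arcsin\<close> is not differentiable there.
  The fundamental theorem is therefore used in its version for nonnegative integrands, with the
  derivative only in the interior and limits at the ends.
\<close>

lemma ellF_reciprocal_modulus: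
  assumes q: "1 < q" and \<gamma>: "0 \<le> \<gamma>" "\<gamma> \<le> pi / 2"
    and conv: "ellF_converges \<gamma> q"
  shows "q * sin \<gamma> \<le> 1" "q * ellF \<gamma> q = ellF (arcsin (q * sin \<gamma>)) (1 / q)"
proof -
  have sin_less: "q * sin \<alpha> < 1" and sin_nonneg: "0 \<le> q * sin \<alpha>" and cos_pos: "0 < cos \<alpha>"
    if "0 < \<alpha>" "\<alpha> < \<gamma>" for \<alpha>
  proof -
    have "\<alpha> \<in> open_segment 0 \<gamma>"
      using that by (auto simp: open_segment_eq_real_ivl)
    then have "(q * sin \<alpha>)\<^sup>2 < 1"
      using conv by (auto simp: ellF_converges_def power_mult_distrib)
    then show "q * sin \<alpha> < 1"
      by (simp add: abs_square_less_1)
    show "0 \<le> q * sin \<alpha>" "0 < cos \<alpha>"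
      using that \<gamma> q by (auto intro!: mult_nonneg_nonneg sin_ge_zero cos_gt_zero_pi)
  qed
  \<comment> \<open>Convergence speaks of the open interval only; the bound passes to its ends by continuity.\<close>
  have le: "q * sin \<alpha> \<le> 1" if "\<alpha> \<in> {0..\<gamma>}" for \<alpha>
  proof (cases "\<gamma> = 0")
    case True
    then show ?thesis
      using that by simp
  next
    case False
    have "closure {0<..<\<gamma>} \<subseteq> {\<alpha>. q * sin \<alpha> \<le> 1}"
      using sin_less
      by (intro closure_minimal closed_Collect_le continuous_intros) (auto intro: less_imp_le)
    then show ?thesis
      using False \<gamma> that by auto
  qed
  then show "q * sin \<gamma> \<le> 1"
    using \<gamma> by auto
  define G where "G \<alpha> = ellF (arcsin (q * sin \<alpha>)) (1 / q) / q" for \<alpha>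
  have k: "0 \<le> 1 / q" "1 / q \<le> 1" and dom: "\<And>\<theta>. \<theta> \<in> amplitude_domain (1 / q)"
    using q amplitude_domain_modulus_less_1[of "1 / q"] by auto
  have ge: "- 1 \<le> q * sin \<alpha>" if "\<alpha> \<in> {0..\<gamma>}" for \<alpha>
  proof -
    have "0 \<le> q * sin \<alpha>"
      using that \<gamma> q by (intro mult_nonneg_nonneg sin_ge_zero) auto
    then show ?thesis by simp
  qed
  have "continuous_on UNIV (\<lambda>\<theta>. ellF \<theta> (1 / q))"
    by (intro continuous_at_imp_continuous_on ballI DERIV_isCont[OF DERIV_ellF[OF k dom]])
  then have contG: "continuous_on {0..\<gamma>} G"
  proof -
    have "continuous_on {0..\<gamma>} (\<lambda>\<alpha>. arcsin (q * sin \<alpha>))"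
      using le ge by (intro continuous_intros) auto
    from continuous_on_compose2[OF \<open>continuous_on UNIV _\<close> this]
    have "continuous_on {0..\<gamma>} (\<lambda>\<alpha>. ellF (arcsin (q * sin \<alpha>)) (1 / q))"
      by simp
    then show ?thesis
      unfolding G_def[abs_def] using q by (intro continuous_intros) auto
  qed
  have DG: "(G has_real_derivative ellF_integrand q \<alpha>) (at \<alpha>)" if "0 < \<alpha>" "\<alpha> < \<gamma>" for \<alpha>
  proof -
    note bnds = sin_less[OF that] sin_nonneg[OF that] cos_pos[OF that]
    have "((\<lambda>\<alpha>. arcsin (q * sin \<alpha>)) has_real_derivative
        q * cos \<alpha> / sqrt (1 - (q * sin \<alpha>)\<^sup>2)) (at \<alpha>)"
    proof -
      have "((\<lambda>\<alpha>. q * sin \<alpha>) has_real_derivative q * cos \<alpha>) (at \<alpha>)"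
        by (auto intro!: derivative_eq_intros)
      from DERIV_chain2[OF DERIV_arcsin this] show ?thesis
        using bnds by (simp add: divide_inverse mult.commute)
    qed
    from DERIV_chain2[OF DERIV_ellF[OF k dom] this]
    have "(G has_real_derivative
        ellF_integrand (1 / q) (arcsin (q * sin \<alpha>)) * (q * cos \<alpha> / sqrt (1 - (q * sin \<alpha>)\<^sup>2)) / q) (at \<alpha>)"
      unfolding G_def[abs_def] by (rule DERIV_cdivide)
    moreover have "ellF_integrand (1 / q) (arcsin (q * sin \<alpha>)) = 1 / cos \<alpha>"
    proof -
      have "1 - (1 / q)\<^sup>2 * (q * sin \<alpha>)\<^sup>2 = (cos \<alpha>)\<^sup>2"
        using q by (simp add: field_simps cos_squared_eq)
      then show ?thesis
        using bnds by (simp add: ellF_integrand_def)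
    qed
    ultimately show ?thesis
      using bnds q by (simp add: ellF_integrand_def power_mult_distrib)
  qed
  have "ellF \<gamma> q = G \<gamma>"
  proof (cases "\<gamma> = 0")
    case False
    then have lt: "0 < \<gamma>"
      using \<gamma> by simp
    have "(LBINT \<alpha>=ereal 0..ereal \<gamma>. ellF_integrand q \<alpha>) = G \<gamma> - G 0"
    proof (rule interval_integral_FTC_nonneg)
      show "ereal 0 < ereal \<gamma>"
        using lt by simp
      show "((G \<circ> real_of_ereal) \<longlongrightarrow> G 0) (at_right (ereal 0))"
        unfolding ereal_tendsto_simps by (rule continuous_on_Icc_at_rightD[OF contG lt])
      show "((G \<circ> real_of_ereal) \<longlongrightarrow> G \<gamma>) (at_left (ereal \<gamma>))"
        unfolding ereal_tendsto_simps by (rule continuous_on_Icc_at_leftD[OF contG lt])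
      fix \<alpha> assume "ereal 0 < ereal \<alpha>" "ereal \<alpha> < ereal \<gamma>"
      then have \<alpha>: "0 < \<alpha>" "\<alpha> < \<gamma>"
        by auto
      show "(G has_real_derivative ellF_integrand q \<alpha>) (at \<alpha>)"
        by (rule DG[OF \<alpha>])
      have "(q * sin \<alpha>)\<^sup>2 < 1"
        using sin_less[OF \<alpha>] sin_nonneg[OF \<alpha>] by (simp add: abs_square_less_1)
      then have "sqrt (1 - q\<^sup>2 * (sin \<alpha>)\<^sup>2) \<noteq> 0"
        by (simp add: power_mult_distrib)
      then show "isCont (ellF_integrand q) \<alpha>"
        unfolding ellF_integrand_def by (intro continuous_intros)
    next
      have "0 \<le> ellF_integrand q \<alpha>" if "0 < \<alpha>" "\<alpha> < \<gamma>" for \<alpha>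
      proof -
        have "(q * sin \<alpha>)\<^sup>2 < 1"
          using sin_less[OF that] sin_nonneg[OF that] by (simp add: abs_square_less_1)
        then show ?thesis
          by (simp add: ellF_integrand_def power_mult_distrib)
      qed
      then show "AE \<alpha> in lborel. ereal 0 < ereal \<alpha> \<longrightarrow> ereal \<alpha> < ereal \<gamma> \<longrightarrow> 0 \<le> ellF_integrand q \<alpha>"
        by auto
    qed
    then show ?thesis
      by (simp add: ellF_def G_def)
  qed (simp add: G_def)
  then show "q * ellF \<gamma> q = ellF (arcsin (q * sin \<gamma>)) (1 / q)"
    using q by (simp add: G_def)
qed

text \<open>
  Convergence up to \<open>pi / 2\<close> would bound all the values \<open>ellF \<gamma> 1 = artanh (sin \<gamma>)\<close>, which are
  unbounded.
\<close>

lemma ellF_diverges_modulus_1: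
  "\<not> ellF_converges (pi / 2) 1"
proof
  assume "ellF_converges (pi / 2) 1"
  then have int: "set_integrable lborel (einterval (ereal 0) (ereal (pi / 2))) (ellF_integrand 1)"
    by (simp add: ellF_converges_def interval_lebesgue_integrable_def)
  define M where "M = ellF (pi / 2) 1"
  \<comment> \<open>The amplitude of \<open>M + 1\<close>; the maximum keeps it nonnegative.\<close>
  define \<gamma> where "\<gamma> = arcsin (tanh (max 0 (M + 1)))"
  have bnd: "- 1 < tanh (max 0 (M + 1))" "tanh (max 0 (M + 1)) < 1"
    using tanh_real_lt_1 tanh_real_gt_neg1 by auto
  have \<gamma>: "0 \<le> \<gamma>" "\<gamma> < pi / 2"
    using arcsin_lt_bounded[OF bnd] bnd arcsin_le_arcsin[of 0 "tanh (max 0 (M + 1))"]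
    by (auto simp: \<gamma>_def)
  have "max 0 (M + 1) = ellF \<gamma> 1"
    using \<gamma> bnd by (subst ellF_modulus_1) (auto simp: \<gamma>_def artanh_tanh_real)
  also have "\<dots> = (LINT \<alpha>:einterval (ereal 0) (ereal \<gamma>)|lborel. ellF_integrand 1 \<alpha>)"
    using \<gamma> by (simp add: ellF_def interval_lebesgue_integral_le_eq)
  also have "\<dots> \<le> (LINT \<alpha>:einterval (ereal 0) (ereal (pi / 2))|lborel. ellF_integrand 1 \<alpha>)"
    using \<gamma> int unfolding set_lebesgue_integral_def
    by (intro integral_mono')
      (auto simp: set_integrable_def ellF_integrand_def abs_square_le_1 indicator_def einterval_iff)
  also have "\<dots> = M"
    by (simp add: M_def ellF_def interval_lebesgue_integral_le_eq)
  finally show False by simp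
qed

section \<open>The solution on the given energy level\<close>

text \<open>
  The momentum \<open>\<eta>'\<close> of the explicit solution at time 0 and \<open>\<eta>\<close> have equal squares, because
  both pairs lie on the energy level through the three roots.  Choosing the sign of the initial angle
  as that of \<open>\<eta>\<close> makes them equal.
\<close>

lemma sn_squared_solution_of_energy:
  fixes a c y \<eta> k \<gamma> :: real
  assumes "c < a" "a + 2 * c < 0"
    and k: "0 \<le> k" "k \<le> 1" and k_sq: "k\<^sup>2 * (a - c) = - (a + 2 * c)"
    and \<gamma>: "\<gamma> \<in> amplitude_domain k" "0 \<le> \<gamma>" "\<gamma> \<le> pi / 2"
    and y: "y = c - (a + 2 * c) * (sin \<gamma>)\<^sup>2"
    and energy: "hamiltonian a c y \<eta> = a * c * (a + c) / 3"
  shows "\<exists>\<xi>. solves_hamiltonian_system a c y \<eta>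
    (\<lambda>t. c - (a + 2 * c) *
      (sin (jacobi_am (sqrt ((a - c) / 6) * t + (if 0 \<le> \<eta> then 1 else - 1) * ellF \<gamma> k) k))\<^sup>2) \<xi>"
proof -
  define \<sigma> where "\<sigma> = (if 0 \<le> \<eta> then 1 else - 1) * \<gamma>"
  define \<omega> where "\<omega> = sqrt ((a - c) / 6)"
  define \<Delta> where "\<Delta> = sqrt (1 - k\<^sup>2 * (sin \<sigma>)\<^sup>2)"
  define \<eta>' where "\<eta>' = - (2 * (a + 2 * c) * \<omega> * sin \<sigma> * cos \<sigma> * \<Delta>)"
  have \<omega>: "0 \<le> \<omega>" "\<omega>\<^sup>2 = (a - c) / 6"
    using assms(1) by (auto simp: \<omega>_def)
  have \<sigma>_dom: "\<sigma> \<in> amplitude_domain k"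
    using \<gamma>(1) by (auto simp: \<sigma>_def amplitude_domain_uminus)
  have sin_sq: "(sin \<sigma>)\<^sup>2 = (sin \<gamma>)\<^sup>2"
    by (simp add: \<sigma>_def)
  have \<Delta>: "0 \<le> \<Delta>" "\<Delta>\<^sup>2 = 1 - k\<^sup>2 * (sin \<gamma>)\<^sup>2"
    using amplitude_domain_radicand_pos[OF \<sigma>_dom] by (auto simp: \<Delta>_def sin_sq)
  have "\<eta>\<^sup>2 = \<eta>'\<^sup>2"
  proof -
    define S where "S = (sin \<gamma>)\<^sup>2"
    define K where "K = k\<^sup>2"
    have "\<eta>\<^sup>2 = 2 / 3 * (y - c) * (y + a + c) * (y - a)"
      using energy by (simp add: hamiltonian_def coeffB_def field_simps power2_eq_square power3_eq_cube)
    also have "\<dots> = 2 / 3 * (- (a + 2 * c) * S) * ((a + 2 * c) * (1 - S)) *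
        - ((a - c) - K * (a - c) * S)"
    proof -
      have "y - c = - (a + 2 * c) * S" "y + a + c = (a + 2 * c) * (1 - S)"
        by (simp_all add: y S_def) (simp_all add: algebra_simps)
      moreover have "y - a = - ((a - c) - K * (a - c) * S)"
        unfolding K_def k_sq by (simp add: y S_def algebra_simps)
      ultimately show ?thesis by (simp only:)
    qed
    also have "\<dots> = 4 * (a + 2 * c)\<^sup>2 * ((a - c) / 6) * S * (1 - S) * (1 - K * S)"
      by (simp add: field_simps power2_eq_square)
    also have "\<dots> = \<eta>'\<^sup>2"
      unfolding \<eta>'_def power2_minus power_mult_distrib \<omega>(2) \<Delta>(2) sin_sq cos_squared_eq S_def K_def
      by simp
    finally show ?thesis .
  qed
  moreover obtain P where "\<eta>' = (if 0 \<le> \<eta> then 2 * P else - (2 * P))" "0 \<le> P"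
  proof
    let ?P = "- (a + 2 * c) * \<omega> * sin \<gamma> * cos \<gamma> * \<Delta>"
    show "\<eta>' = (if 0 \<le> \<eta> then 2 * ?P else - (2 * ?P))"
      by (simp add: \<eta>'_def \<sigma>_def algebra_simps)
    show "0 \<le> ?P"
      using assms(2) \<gamma> \<omega>(1) \<Delta>(1)
      by (intro mult_nonneg_nonneg sin_ge_zero cos_ge_zero) auto
  qed
  ultimately have "\<eta>' = \<eta>"
    by (auto simp: power2_eq_iff split: if_splits)
  moreover have "ellF \<sigma> k = (if 0 \<le> \<eta> then 1 else - 1) * ellF \<gamma> k"
    by (simp add: \<sigma>_def ellF_uminus)
  ultimately show ?thesis
    using sn_squared_solves_hamiltonian_system[OF k k_sq \<omega>(2) \<sigma>_dom \<Delta>_def]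
    unfolding sin_sq y[symmetric] \<eta>'_def[symmetric] \<omega>_def[symmetric] by (simp only:)
qed

text \<open>The coefficients of the system are symmetric in the three roots, which sum to 0.\<close>

lemma solves_hamiltonian_system_swap_roots:
  "solves_hamiltonian_system (- a - c) c = solves_hamiltonian_system a c"
proof -
  have "(- a - c)\<^sup>2 + c\<^sup>2 + (- a - c) * c = a\<^sup>2 + c\<^sup>2 + a * c"
    by (simp add: power2_eq_square algebra_simps)
  then show ?thesis
    by (simp only: fun_eq_iff solves_hamiltonian_system_def simp_thms)
qed

lemma hamiltonian_swap_roots:
  "hamiltonian (- a - c) c = hamiltonian a c"
  by (simp add: fun_eq_iff hamiltonian_def coeffB_def power2_eq_square algebra_simps)

text \<open>
  For \<open>q > 1\<close> the amplitude of modulus \<open>q\<close> is unavailable.  The solution comes instead from the roots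
  with \<open>a\<close> and \<open>b\<close> exchanged, where the modulus is \<open>1 / q\<close>, the frequency is \<open>q\<close> times the old one and,
  by the reciprocal modulus transformation, so is the phase.
\<close>

lemma jacobi_sn_solution_of_energy:
  fixes a c y \<eta> q \<gamma> :: real
  assumes "c < a" "a + 2 * c < 0"
    and q: "0 \<le> q" and q_sq: "q\<^sup>2 * (a - c) = - (a + 2 * c)"
    and \<gamma>: "0 \<le> \<gamma>" "\<gamma> \<le> pi / 2"
    and conv: "ellF_converges \<gamma> q"
    and y: "y = c - (a + 2 * c) * (sin \<gamma>)\<^sup>2"
    and energy: "hamiltonian a c y \<eta> = a * c * (a + c) / 3"
  shows "\<exists>\<xi>. solves_hamiltonian_system a c y \<eta>
    (\<lambda>t. c - (a + 2 * c) *
      (jacobi_sn (sqrt ((a - c) / 6) * t + (if 0 \<le> \<eta> then 1 else - 1) * ellF \<gamma> q) q)\<^sup>2) \<xi>"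
proof (cases "q \<le> 1")
  case True
  have "\<gamma> \<in> amplitude_domain q"
  proof (cases "q = 1")
    case q1: True
    then have "\<gamma> \<noteq> pi / 2"
      using conv ellF_diverges_modulus_1 by blast
    with \<gamma>(2) have "\<gamma> < pi / 2"
      by (rule le_neq_trans)
    moreover have "- pi / 2 < \<gamma>"
      using \<gamma>(1) pi_gt_zero by linarith
    ultimately show ?thesis
      using q1 by (simp add: amplitude_domain_modulus_1)
  qed (use True q amplitude_domain_modulus_less_1[of q] in auto)
  from sn_squared_solution_of_energy[OF assms(1,2) q True q_sq this \<gamma> y energy]
  show ?thesis
    using True q by (simp add: jacobi_sn_def)
next
  case False
  then have q1: "1 < q"
    by simp
  define b where "b = - a - c"
  \<comment> \<open>The initial angle for the exchanged roots.\<close>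
  define \<theta> where "\<theta> = arcsin (q * sin \<gamma>)"
  note reciprocal = ellF_reciprocal_modulus[OF q1 \<gamma> conv]
  have sin_nonneg: "0 \<le> q * sin \<gamma>"
    using \<gamma> q by (intro mult_nonneg_nonneg sin_ge_zero) auto
  have sin: "sin \<theta> = q * sin \<gamma>"
    using sin_nonneg reciprocal(1) by (simp add: \<theta>_def)
  have bc: "b - c = q\<^sup>2 * (a - c)" and ac: "- (b + 2 * c) = a - c"
    using q_sq by (auto simp: b_def)
  have \<theta>: "0 \<le> \<theta>" "\<theta> \<le> pi / 2"
    using sin_nonneg reciprocal(1) arcsin_bounded[of "q * sin \<gamma>"] arcsin_le_arcsin[of 0 "q * sin \<gamma>"]
    by (auto simp: \<theta>_def)
  have "\<exists>\<xi>. solves_hamiltonian_system b c y \<eta>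
    (\<lambda>t. c - (b + 2 * c) *
      (sin (jacobi_am (sqrt ((b - c) / 6) * t + (if 0 \<le> \<eta> then 1 else - 1) * ellF \<theta> (1 / q)) (1 / q)))\<^sup>2) \<xi>"
  proof (rule sn_squared_solution_of_energy)
    show "c < b" "b + 2 * c < 0"
      using assms(1,2) by (auto simp: b_def)
    show "0 \<le> 1 / q" "1 / q \<le> 1" "\<theta> \<in> amplitude_domain (1 / q)"
      using q1 amplitude_domain_modulus_less_1[of "1 / q"] by auto
    show "(1 / q)\<^sup>2 * (b - c) = - (b + 2 * c)"
      unfolding bc ac using q1 by (simp add: power_divide)
    have "y = c + q\<^sup>2 * (a - c) * (sin \<gamma>)\<^sup>2"
      unfolding q_sq by (simp add: y algebra_simps)
    also have "\<dots> = c - (b + 2 * c) * (sin \<theta>)\<^sup>2"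
      unfolding sin by (simp add: b_def power_mult_distrib algebra_simps)
    finally show "y = c - (b + 2 * c) * (sin \<theta>)\<^sup>2" .
    show "hamiltonian b c y \<eta> = b * c * (b + c) / 3"
      using energy by (simp add: b_def hamiltonian_swap_roots algebra_simps)
  qed (use \<theta> in auto)
  moreover have "c - (b + 2 * c) *
      (sin (jacobi_am (sqrt ((b - c) / 6) * t + (if 0 \<le> \<eta> then 1 else - 1) * ellF \<theta> (1 / q)) (1 / q)))\<^sup>2
    = c - (a + 2 * c) *
      (jacobi_sn (sqrt ((a - c) / 6) * t + (if 0 \<le> \<eta> then 1 else - 1) * ellF \<gamma> q) q)\<^sup>2" for t
  proof -
    define u where "u = sqrt ((a - c) / 6) * t + (if 0 \<le> \<eta> then 1 else - 1) * ellF \<gamma> q"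
    have "sqrt ((b - c) / 6) = sqrt (q\<^sup>2 * ((a - c) / 6))"
      by (simp add: bc)
    also have "\<dots> = q * sqrt ((a - c) / 6)"
      using q by (simp only: real_sqrt_mult real_sqrt_abs abs_of_nonneg)
    finally have "sqrt ((b - c) / 6) * t + (if 0 \<le> \<eta> then 1 else - 1) * ellF \<theta> (1 / q) = q * u"
      using reciprocal(2) by (simp add: u_def \<theta>_def algebra_simps)
    moreover have "sin (jacobi_am (q * u) (1 / q)) = q * jacobi_sn u q"
      using q1 by (simp add: jacobi_sn_def)
    moreover have "(b + 2 * c) * (q * jacobi_sn u q)\<^sup>2 = - (q\<^sup>2 * (a - c)) * (jacobi_sn u q)\<^sup>2"
      by (simp add: b_def power_mult_distrib algebra_simps)
    ultimately show ?thesis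
      unfolding u_def[symmetric] q_sq by simp
  qed
  ultimately show ?thesis
    by (simp add: b_def solves_hamiltonian_system_swap_roots)
qed

theorem theorem2p1:
  fixes a c y \<eta> q i\<^sub>y :: real
  assumes "c < 0" and "0 < a" and "2 * c + a < 0"
    and "y \<in> {c..- a - c}"
    and "hamiltonian a c y \<eta> = a * c * (a + c) / 3"
    and "q = sqrt ((2 * c + a) / (c - a))"
    and "ellF_converges (arcsin (sqrt ((c - y) / (2 * c + a)))) q"
    and "i\<^sub>y = ellF (arcsin (sqrt ((c - y) / (2 * c + a)))) q"
  shows "\<exists>x\<^sub>0 \<xi>\<^sub>0.
    solves_hamiltonian_system a c y \<eta> x\<^sub>0 \<xi>\<^sub>0 \<and>
    (\<forall>x \<xi>. solves_hamiltonian_system a c y \<eta> x \<xi> \<longrightarrow> (\<forall>t\<ge>0. x t = x\<^sub>0 t \<and> \<xi> t = \<xi>\<^sub>0 t)) \<and>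
    (0 \<le> \<eta> \<longrightarrow> (\<forall>t\<ge>0. x\<^sub>0 t = c - (a + 2 * c) * (jacobi_sn (sqrt ((a - c) / 6) * t + i\<^sub>y) q)\<^sup>2)) \<and>
    (\<eta> < 0 \<longrightarrow> (\<forall>t\<ge>0. x\<^sub>0 t = c - (a + 2 * c) * (jacobi_sn (sqrt ((a - c) / 6) * t - i\<^sub>y) q)\<^sup>2))"
proof -
  define \<gamma> where "\<gamma> = arcsin (sqrt ((c - y) / (2 * c + a)))"
  have ratio: "0 \<le> (c - y) / (2 * c + a)" "(c - y) / (2 * c + a) \<le> 1"
    using assms(3,4) by (auto simp: divide_simps)
  then have sqrt_ratio: "- 1 \<le> sqrt ((c - y) / (2 * c + a))" "sqrt ((c - y) / (2 * c + a)) \<le> 1"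
    by (auto intro: order_trans[of _ 0])
  then have sin: "(sin \<gamma>)\<^sup>2 = (c - y) / (2 * c + a)"
    using ratio(1) by (simp only: \<gamma>_def sin_arcsin real_sqrt_pow2)
  have \<gamma>: "0 \<le> \<gamma>" "\<gamma> \<le> pi / 2"
    using ratio arcsin_bounded[OF sqrt_ratio]
      arcsin_le_arcsin[of 0 "sqrt ((c - y) / (2 * c + a))"]
    by (auto simp: \<gamma>_def)
  have q: "0 \<le> q" "q\<^sup>2 * (a - c) = - (a + 2 * c)"
    using assms(1-3) by (auto simp: assms(6) divide_simps) (simp add: algebra_simps)
  have y: "y = c - (a + 2 * c) * (sin \<gamma>)\<^sup>2"
    using assms(3) by (simp add: sin field_simps)
  define x where "x t = c - (a + 2 * c) *
      (jacobi_sn (sqrt ((a - c) / 6) * t + (if 0 \<le> \<eta> then 1 else - 1) * i\<^sub>y) q)\<^sup>2" for t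
  obtain \<xi> where sol: "solves_hamiltonian_system a c y \<eta> x \<xi>"
    using jacobi_sn_solution_of_energy[OF _ _ q \<gamma> _ y assms(5)] assms(1-3,7)
    unfolding x_def[abs_def] assms(8) \<gamma>_def by auto
  then show ?thesis
    using hamiltonian_system_unique[OF _ sol]
    by (intro exI[of _ x] exI[of _ \<xi>]) (auto simp: x_def)
qed

end
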